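(* Let $S\neq\mathbb Z_{\ge 0}$ be a numerical semigroup, let $m\in S$ be nonzero, and let $c_1<\dots<c_n$ be the elements of $\mathbb Z_{\ge 0}\setminus S$. Let $f:\mathbb Z_{\ge 0}\to\mathbb C$ be an arbitrary function, and let $p$ be an integer with $0<p\le m$. Let $U\subset\mathbb C$ be a simply connected open set, $w$ a holomorphic function on $U$, and $\gamma$ a positively oriented simple closed (piecewise smooth) contour in $U$ whose interior contains the points $f(a)$ for all $a\in I_m\cup S^{(m)}$ and the points $f(c_i),f(c_i+m)$ for all $i=1,\dots,n$. With divided differences $\Delta$ defined by integration over $\gamma$, $$\sum_{i=1}^n\bigl(f(c_i+m)-f(c_i)\bigr)\sum_{J\subset T_i,\ |J|=p-1}\Delta(w(z);f\{J\},f(c_i),f(c_i+m))=\sum_{I\subset S^{(m)},\ |I|=p}\Delta(w(z);f\{I\})-\sum_{I\subset I_m,\ |I|=p}\Delta(w(z);f\{I\}).$$ In particular, for $p=m$, $$\sum_{i=1}^n\bigl(f(c_i+m)-f(c_i)\bigr)\Delta(w(z);f\{T_i\},f(c_i),f(c_i+m))=\Delta(w(z);f\{S^{(m)}\})-\Delta(w(z);f\{I_m\}),$$ and for $p=m$, $w(z)=z^m$ this reads $$\sum_{c\in\mathbb Z_{\ge 0}\setminus S}\bigl(f(c+m)-f(c)\bigr)=\sum_{a\in S^{(m)}}f(a)-\sum_{i=0}^{m-1}f(i).$$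
   Context: A numerical semigroup is a set $S\subset\mathbb Z_{\ge 0}$ that contains $0$, is closed under addition and has finite complement in $\mathbb Z_{\ge 0}$. For a numerical semigroup $S$ and a nonzero $m\in S$, the Apéry set is $S^{(m)}:=\{s\in S: s-m\notin S\}$; it has exactly $m$ elements, one in each residue class mod $m$, and contains $0$. Put $I_m:=\{0,1,\dots,m-1\}$. With $\mathbb Z_{\ge 0}\setminus S=\{c_1<\dots<c_n\}$, let $S_0:=\mathbb Z_{\ge 0}$ and $S_i:=\mathbb Z_{\ge 0}\setminus\{c_1,\dots,c_i\}$ for $i=1,\dots,n$ (so $S_n=S$); each $S_i$ is a numerical semigroup containing $m$. For $i=1,\dots,n$ put $T_i:=S_i^{(m)}\setminus\{c_i+m\}=S_{i-1}^{(m)}\setminus\{c_i\}$, a set of $m-1$ elements, each of which lies in $I_m$ or is of the form $c_j+m$. For a finite set $A\subset\mathbb Z_{\ge 0}$, $f\{A\}$ denotes the family $(f(a))_{a\in A}$ of $|A|$ values counted with multiplicity, in any order; $(f\{J\},u,v)$ denotes this family with the two further entries $u,v$ appended. The Newton divided difference of $w$ at points $x_1,\dots,x_r$ (not necessarily distinct) in the interior of $\gamma$ is $$\Delta(w(z);x_1,\dots,x_r):=\frac{1}{2\pi\sqrt{-1}}\oint_\gamma\frac{w(z)\,dz}{(z-x_1)\cdots(z-x_r)}.$$ *)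

theory Defs
  imports "HOL-Complex_Analysis.Complex_Analysis" "HOL-Library.Multiset"
begin

definition numerical_semigroup :: "nat set \<Rightarrow> bool" where
  "numerical_semigroup S \<longleftrightarrow>
     0 \<in> S \<and> (\<forall>a\<in>S. \<forall>b\<in>S. a + b \<in> S) \<and> finite (UNIV - S)"

text \<open>The difference \<open>s - m\<close> is taken in the integers, so that \<open>s - m \<notin> S\<close> holds whenever \<open>s < m\<close>.\<close>

definition apery :: "nat set \<Rightarrow> nat \<Rightarrow> nat set" where
  "apery S m = {s \<in> S. int s - int m \<notin> int ` S}"

text \<open>Here \<open>c 1 < \<dots> < c n\<close> enumerates the gaps of a numerical semigroup; \<open>gap_chain c i\<close> is
  \<open>S\<^sub>i\<close> and \<open>gap_T c m i\<close> is \<open>T\<^sub>i\<close>.\<close>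

definition gap_chain :: "(nat \<Rightarrow> nat) \<Rightarrow> nat \<Rightarrow> nat set" where
  "gap_chain c i = UNIV - c ` {1..i}"

definition gap_T :: "(nat \<Rightarrow> nat) \<Rightarrow> nat \<Rightarrow> nat \<Rightarrow> nat set" where
  "gap_T c m i = apery (gap_chain c i) m - {c i + m}"

text \<open>The family \<open>f{A}\<close> for a finite set \<open>A\<close> (\<open>mset_set\<close> of an infinite set is empty).\<close>

definition family :: "(nat \<Rightarrow> complex) \<Rightarrow> nat set \<Rightarrow> complex multiset" where
  "family f A = image_mset f (mset_set A)"

definition divided_difference ::
  "(real \<Rightarrow> complex) \<Rightarrow> (complex \<Rightarrow> complex) \<Rightarrow> complex multiset \<Rightarrow> complex" where
  "divided_difference \<gamma> w X =
     1 / (2 * of_real pi * \<i>) * contour_integral \<gamma> (\<lambda>z. w z / (\<Prod>x\<in>#X. z - x))"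

text \<open>The interior of a simple closed contour is the bounded component \<open>inside (path_image \<gamma>)\<close>
  of its complement; positive orientation means winding number 1 around the interior points.\<close>

definition positive_simple_closed_contour :: "(real \<Rightarrow> complex) \<Rightarrow> bool" where
  "positive_simple_closed_contour \<gamma> \<longleftrightarrow>
     valid_path \<gamma> \<and> simple_path \<gamma> \<and> pathfinish \<gamma> = pathstart \<gamma> \<and>
     (\<forall>z \<in> inside (path_image \<gamma>). winding_number \<gamma> z = 1)"

end

theory Submission
  imports Defs
begin

text \<open>When the gaps are removed from the naturals one at a time, the Apery set of \<open>S\<^sub>i\<close> arises from that of \<open>S\<^bsub>i-1\<^esub>\<close>
  by replacing \<open>c\<^sub>i\<close> with \<open>c\<^sub>i + m\<close>. Hence the sum over \<open>p\<close>-subsets changes only in the subsets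
  \<open>J \<union> {c\<^sub>i}\<close>, which become \<open>J \<union> {c\<^sub>i + m}\<close>, and the recurrence of divided differences gives the
  change as the \<open>i\<close>-th summand. Everything telescopes from \<open>{0..<m}\<close> to the Apery set of \<open>S\<close>.\<close>

section \<open>Divided differences as contour integrals\<close>

lemma holomorphic_on_prod_mset_diff:
  "(\<lambda>z::complex. \<Prod>x\<in>#X. z - x) holomorphic_on A"
  by (induction X) (auto intro!: holomorphic_intros)

lemma contour_integrable_divided_difference:
  assumes "open U" "w holomorphic_on U" "valid_path \<gamma>" "path_image \<gamma> \<subseteq> U"
    and "set_mset X \<inter> path_image \<gamma> = {}"
  shows "(\<lambda>z. w z / (\<Prod>x\<in>#X. z - x)) contour_integrable_on \<gamma>"
proof (rule contour_integrable_holomorphic_simple)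
  show "open (U - set_mset X)"
    using assms(1) by (simp add: open_Diff finite_imp_closed)
  show "(\<lambda>z. w z / (\<Prod>x\<in>#X. z - x)) holomorphic_on (U - set_mset X)"
    using assms(2) by (intro holomorphic_on_divide holomorphic_on_prod_mset_diff)
      (auto intro: holomorphic_on_subset simp: prod_mset_zero_iff)
qed (use assms in auto)

text \<open>Partial fractions:
  \<open>(b - a) / ((z - a) * (z - b)) = 1 / (z - b) - 1 / (z - a)\<close> pointwise on the path,
  then integrate. Nothing is divided by \<open>b - a\<close>, so coinciding nodes are
  covered.\<close>

lemma divided_difference_recurrence:
  assumes "open U" "w holomorphic_on U" "valid_path \<gamma>" "path_image \<gamma> \<subseteq> U"
    and X: "set_mset (X + {#a, b#}) \<inter> path_image \<gamma> = {}"
  shows "(b - a) * divided_difference \<gamma> w (X + {#a, b#}) =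
    divided_difference \<gamma> w (add_mset b X) - divided_difference \<gamma> w (add_mset a X)"
proof -
  let ?F = "\<lambda>Y z. w z / (\<Prod>x\<in>#Y. z - x)"
  have int: "?F Y contour_integrable_on \<gamma>" if "set_mset Y \<subseteq> set_mset (X + {#a, b#})" for Y
    using that X by (intro contour_integrable_divided_difference[OF assms(1-4)]) blast
  have "(b - a) * contour_integral \<gamma> (?F (X + {#a, b#}))
      = contour_integral \<gamma> (\<lambda>z. (b - a) * ?F (X + {#a, b#}) z)"
    by (rule contour_integral_lmul[symmetric], rule int) simp
  also have "\<dots> = contour_integral \<gamma> (\<lambda>z. ?F (add_mset b X) z - ?F (add_mset a X) z)"
  proof (rule contour_integral_eq)
    fix z assume "z \<in> path_image \<gamma>"
    then have "z - a \<noteq> 0" "z - b \<noteq> 0" "(\<Prod>x\<in>#X. z - x) \<noteq> 0"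
      using X by (auto simp: prod_mset_zero_iff)
    then show "(b - a) * ?F (X + {#a, b#}) z = ?F (add_mset b X) z - ?F (add_mset a X) z"
      by (simp add: divide_simps) (simp add: algebra_simps)
  qed
  also have "\<dots> = contour_integral \<gamma> (?F (add_mset b X)) - contour_integral \<gamma> (?F (add_mset a X))"
    by (rule contour_integral_diff; rule int) auto
  finally show ?thesis
    unfolding divided_difference_def by (simp add: field_simps)
qed

section \<open>Families and sums over subsets of fixed size\<close>

lemma family_insert:
  "finite A \<Longrightarrow> a \<notin> A \<Longrightarrow> family f (insert a A) = add_mset (f a) (family f A)"
  by (simp add: family_def)

text \<open>Split the \<open>p\<close>-subsets by whether they contain \<open>a\<close>; deleting
  \<open>a\<close> from those that do leaves the sets \<open>J\<close>. With \<open>p = 0\<close>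
  the truncated \<open>p - 1\<close> would admit a spurious term \<open>g {a}\<close>.\<close>

lemma sum_subsets_insert:
  fixes g :: "'a set \<Rightarrow> 'b::comm_monoid_add"
  assumes "finite T" "a \<notin> T" "0 < p"
  shows "(\<Sum>I | I \<subseteq> insert a T \<and> card I = p. g I) =
    (\<Sum>I | I \<subseteq> T \<and> card I = p. g I) + (\<Sum>J | J \<subseteq> T \<and> card J = p - 1. g (insert a J))"
proof -
  let ?B = "{J. J \<subseteq> T \<and> card J = p - 1}"
  have inj: "inj_on (insert a) ?B"
    using assms(2) by (auto simp: inj_on_def)
  have "card (insert a J) = p" if "J \<in> ?B" for J
  proof -
    have "finite J" "a \<notin> J" using that assms(1,2) by (auto intro: finite_subset)
    then show ?thesis using that assms(3) by simp
  qed
  moreover have "I \<in> insert a ` ?B" if "I \<subseteq> insert a T" "card I = p" "\<not> I \<subseteq> T" for I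
  proof
    show "I = insert a (I - {a})" using that by auto
    show "I - {a} \<in> ?B"
      using that by (auto simp: card_Diff_singleton)
  qed
  ultimately have eq: "{I. I \<subseteq> insert a T \<and> card I = p} =
      {I. I \<subseteq> T \<and> card I = p} \<union> insert a ` ?B"
    by blast
  show ?thesis
    unfolding eq using assms(1,2)
    by (subst sum.union_disjoint) (auto simp: sum.reindex[OF inj, unfolded One_nat_def])
qed

lemma subsets_full_card:
  assumes "finite A" "card A = k"
  shows "{I. I \<subseteq> A \<and> card I = k} = {A}"
  using assms by (auto dest: card_subset_eq)

lemma sum_telescope_from_1:
  fixes h :: "nat \<Rightarrow> 'a::ab_group_add"
  shows "(\<Sum>i=1..n. h i - h (i - 1)) = h n - h 0"
  by (induction n) auto

section \<open>Apery sets along the chain of gap removals\<close>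

lemma apery_alt: "apery S m = {s \<in> S. m \<le> s \<longrightarrow> s - m \<notin> S}"
proof -
  \<comment> \<open>For \<open>s < m\<close> the truncated \<open>s - m\<close> is \<open>0\<close>,
    an element of every numerical semigroup; the guard \<open>m \<le> s\<close> restores the integer
    meaning.\<close>
  have "int s - int m \<in> int ` S \<longleftrightarrow> m \<le> s \<and> s - m \<in> S" for s
    by (auto intro!: image_eqI[of _ int "s - m"] simp: of_nat_diff)
      (metis add.commute add_diff_cancel_right' diff_eq_eq of_nat_add of_nat_eq_iff)
  then show ?thesis by (auto simp: apery_def)
qed

lemma apery_UNIV: "apery UNIV m = {0..<m}"
  by (auto simp: apery_alt)

text \<open>Deleting \<open>a\<close> can affect the Apery condition only at \<open>a\<close> itself
  and at \<open>a + m\<close>, whose shift down by \<open>m\<close> is \<open>a\<close>.\<close>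

lemma apery_remove:
  assumes "a \<in> S" "0 < m" "m \<le> a \<Longrightarrow> a - m \<notin> S" "a + m \<in> S"
  shows "a \<in> apery S m" "a + m \<notin> apery S m" "a + m \<in> apery (S - {a}) m"
    "apery (S - {a}) m - {a + m} = apery S m - {a}"
  using assms by (auto simp: apery_alt)

lemma gap_chain_Suc: "gap_chain c (Suc i) = gap_chain c i - {c (Suc i)}"
  by (auto simp: gap_chain_def atLeastAtMostSuc_conv)

text \<open>If \<open>s \<ge> m\<close> lies in the Apery set, then \<open>s - m\<close> is missing
  from the chain, hence is one of the gaps removed so far. This gives finiteness and later locates
  the nodes relative to the contour.\<close>

lemma apery_gap_chain_subset: "apery (gap_chain c i) m \<subseteq> {0..<m} \<union> (\<lambda>j. c j + m) ` {1..i}"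
  by (force simp: apery_alt gap_chain_def image_iff)

lemma finite_apery_gap_chain: "finite (apery (gap_chain c i) m)"
  by (rule finite_subset[OF apery_gap_chain_subset]) auto

lemma finite_gap_T: "finite (gap_T c m i)"
  by (simp add: gap_T_def finite_apery_gap_chain)

lemma gap_T_step:
  assumes S: "numerical_semigroup S" "m \<in> S" "0 < m"
    and c: "strict_mono_on {1..n} c" "c ` {1..n} = UNIV - S" and i: "i \<in> {1..n}"
  shows "apery (gap_chain c i) m = insert (c i + m) (gap_T c m i)"
    "apery (gap_chain c (i - 1)) m = insert (c i) (gap_T c m i)"
    "c i \<notin> gap_T c m i" "c i + m \<notin> gap_T c m i"
proof -
  have less: "j < k" if "c j < c k" "j \<in> {1..n}" "k \<in> {1..n}" for j k
    using that strict_mono_on_less[OF c(1)] by blast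
  have ch: "gap_chain c i = gap_chain c (i - 1) - {c i}"
    using gap_chain_Suc[of c "i - 1"] i by simp
  have mem: "c i \<in> gap_chain c (i - 1)"
    using i strict_mono_on_eq[OF c(1)] by (force simp: gap_chain_def)
  \<comment> \<open>If \<open>c i - m\<close> were in \<open>S\<close>, adding \<open>m\<close>
    would put \<open>c i\<close> in \<open>S\<close>. So it is a gap smaller than
    \<open>c i\<close>, removed at an earlier stage.\<close>
  have down: "c i - m \<notin> gap_chain c (i - 1)" if "m \<le> c i"
  proof -
    have "c i \<notin> S" using c(2) i by blast
    moreover have "c i - m + m = c i" using that by simp
    ultimately have "c i - m \<notin> S"
      using S by (metis numerical_semigroup_def)
    then obtain j where j: "j \<in> {1..n}" "c j = c i - m"
      using c(2) by (metis DiffI UNIV_I imageE)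
    then have "j < i" using less[of j i] i S(3) that by simp
    then show ?thesis using j by (force simp: gap_chain_def)
  qed
  \<comment> \<open>Even if \<open>c i + m\<close> is a gap, it is larger than \<open>c i\<close>
    and has not been removed yet.\<close>
  have up: "c i + m \<in> gap_chain c (i - 1)"
  proof -
    have False if "c i + m = c j" "j \<in> {1..i - 1}" for j
      using less[of i j] that i S(3) by simp linarith
    then show ?thesis unfolding gap_chain_def by blast
  qed
  note r = apery_remove[OF mem S(3) down up, folded ch]
  show "apery (gap_chain c i) m = insert (c i + m) (gap_T c m i)"
    "apery (gap_chain c (i - 1)) m = insert (c i) (gap_T c m i)"
    "c i \<notin> gap_T c m i" "c i + m \<notin> gap_T c m i"
    using r unfolding gap_T_def by blast+
qed

text \<open>Each stage exchanges one element for another, so the size stays that of the initial set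
  \<open>{0..<m}\<close>.\<close>

lemma card_apery_gap_chain:
  assumes "numerical_semigroup S" "m \<in> S" "0 < m"
    and "strict_mono_on {1..n} c" "c ` {1..n} = UNIV - S" and "i \<le> n"
  shows "card (apery (gap_chain c i) m) = m"
  using assms(6)
proof (induction i)
  case 0
  then show ?case by (simp add: gap_chain_def apery_UNIV)
next
  case (Suc i)
  then show ?case
    using gap_T_step[OF assms(1-5), of "Suc i"] by (simp add: finite_gap_T)
qed

lemma card_gap_T:
  assumes "numerical_semigroup S" "m \<in> S" "0 < m"
    and "strict_mono_on {1..n} c" "c ` {1..n} = UNIV - S" and "i \<in> {1..n}"
  shows "card (gap_T c m i) = m - 1"
  using card_apery_gap_chain[OF assms(1-5), of i] gap_T_step(1,4)[OF assms] assms(6)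
  by (simp add: finite_gap_T)

theorem mainTheorem5:
  fixes S :: "nat set" and m n :: nat and c :: "nat \<Rightarrow> nat" and f :: "nat \<Rightarrow> complex"
  assumes "numerical_semigroup S" and "S \<noteq> UNIV"
    and "m \<in> S" and "m \<noteq> 0"
    and "strict_mono_on {1..n} c" and "c ` {1..n} = UNIV - S"
  shows
    "(\<forall>(U :: complex set) (w :: complex \<Rightarrow> complex) (\<gamma> :: real \<Rightarrow> complex).
        open U \<and> simply_connected U \<and> w holomorphic_on U \<and>
        positive_simple_closed_contour \<gamma> \<and> path_image \<gamma> \<subseteq> U \<and>
        (\<forall>a \<in> {0..<m} \<union> apery S m. f a \<in> inside (path_image \<gamma>)) \<and>
        (\<forall>i \<in> {1..n}. f (c i) \<in> inside (path_image \<gamma>) \<and> f (c i + m) \<in> inside (path_image \<gamma>))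
        \<longrightarrow>
        (\<forall>p :: nat. 0 < p \<and> p \<le> m \<longrightarrow>
          (\<Sum>i=1..n. (f (c i + m) - f (c i)) *
             (\<Sum>J | J \<subseteq> gap_T c m i \<and> card J = p - 1.
                divided_difference \<gamma> w (family f J + {#f (c i), f (c i + m)#})))
          = (\<Sum>I | I \<subseteq> apery S m \<and> card I = p. divided_difference \<gamma> w (family f I))
            - (\<Sum>I | I \<subseteq> {0..<m} \<and> card I = p. divided_difference \<gamma> w (family f I)))
        \<and>
        (\<Sum>i=1..n. (f (c i + m) - f (c i)) *
           divided_difference \<gamma> w (family f (gap_T c m i) + {#f (c i), f (c i + m)#}))
        = divided_difference \<gamma> w (family f (apery S m))
          - divided_difference \<gamma> w (family f {0..<m}))
     \<and>
     (\<Sum>g \<in> UNIV - S. f (g + m) - f g) = (\<Sum>a \<in> apery S m. f a) - (\<Sum>i=0..<m. f i)"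
proof (intro conjI allI impI)
  have m: "0 < m" using assms(4) by simp
  note hyps = assms(1,3) m assms(5,6)
  note step = gap_T_step[OF hyps]
  \<comment> \<open>Stage \<open>0\<close> removes nothing, since \<open>{1..0}\<close> is empty;
    stage \<open>n\<close> has removed every gap and leaves \<open>S\<close>.\<close>
  have ends: "apery (gap_chain c 0) m = {0..<m}" "apery (gap_chain c n) m = apery S m"
    using assms(6) by (simp_all add: gap_chain_def apery_UNIV double_diff)
  \<comment> \<open>The identity for \<open>f\<close> alone telescopes \<open>sum f\<close> over the
    same chain, without passing through divided differences of the \<open>m\<close>-th
    power.\<close>
  have "(\<Sum>g \<in> UNIV - S. f (g + m) - f g) = (\<Sum>i=1..n. f (c i + m) - f (c i))"
    unfolding assms(6)[symmetric] sum.reindex[OF strict_mono_on_imp_inj_on[OF assms(5)]] o_def ..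
  also have "\<dots> = (\<Sum>i=1..n. sum f (apery (gap_chain c i) m) - sum f (apery (gap_chain c (i - 1)) m))"
    by (intro sum.cong refl) (simp add: step finite_gap_T del: One_nat_def)
  also have "\<dots> = (\<Sum>a \<in> apery S m. f a) - (\<Sum>i=0..<m. f i)"
    using sum_telescope_from_1[of "\<lambda>i. sum f (apery (gap_chain c i) m)" n] ends by simp
  finally show "(\<Sum>g \<in> UNIV - S. f (g + m) - f g) = (\<Sum>a \<in> apery S m. f a) - (\<Sum>i=0..<m. f i)" .

  fix U :: "complex set" and w :: "complex \<Rightarrow> complex" and \<gamma> :: "real \<Rightarrow> complex"
  assume H: "open U \<and> simply_connected U \<and> w holomorphic_on U \<and>
        positive_simple_closed_contour \<gamma> \<and> path_image \<gamma> \<subseteq> U \<and>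
        (\<forall>a \<in> {0..<m} \<union> apery S m. f a \<in> inside (path_image \<gamma>)) \<and>
        (\<forall>i \<in> {1..n}. f (c i) \<in> inside (path_image \<gamma>) \<and> f (c i + m) \<in> inside (path_image \<gamma>))"
  then have \<gamma>: "open U" "w holomorphic_on U" "valid_path \<gamma>" "path_image \<gamma> \<subseteq> U"
    by (auto simp: positive_simple_closed_contour_def)
  \<comment> \<open>The inside of a path is disjoint from its image, so the contour hypotheses keep
    all possible nodes off the path.\<close>
  have off: "f a \<notin> path_image \<gamma>" if "a \<in> {0..<m} \<union> c ` {1..n} \<union> (\<lambda>j. c j + m) ` {1..n}" for a
    using that H inside_no_overlap[of "path_image \<gamma>"] by blast
  let ?D = "\<lambda>I. divided_difference \<gamma> w (family f I)"
  let ?E = "\<lambda>J i. divided_difference \<gamma> w (family f J + {#f (c i), f (c i + m)#})"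
  \<comment> \<open>The recurrence with nodes \<open>a = f (c i)\<close> and
    \<open>b = f (c i + m)\<close>. Since \<open>J\<close> contains neither index, each insertion
    appends exactly one value, even where \<open>f\<close> repeats values.\<close>
  have rec: "(f (c i + m) - f (c i)) * ?E J i = ?D (insert (c i + m) J) - ?D (insert (c i) J)"
    if i: "i \<in> {1..n}" and J: "J \<subseteq> gap_T c m i" for i J
  proof -
    have fin: "finite J" using J finite_gap_T finite_subset by blast
    have "gap_T c m i \<subseteq> {0..<m} \<union> (\<lambda>j. c j + m) ` {1..i}"
      using apery_gap_chain_subset unfolding gap_T_def by blast
    also have "\<dots> \<subseteq> {0..<m} \<union> (\<lambda>j. c j + m) ` {1..n}" using i by auto
    finally have "f a \<notin> path_image \<gamma>" if "a \<in> J \<union> {c i, c i + m}" for a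
      using off[of a] that i J by blast
    then have "set_mset (family f J + {#f (c i), f (c i + m)#}) \<inter> path_image \<gamma> = {}"
      using fin by (auto simp: family_def)
    note divided_difference_recurrence[OF \<gamma> this]
    moreover have "c i \<notin> J" "c i + m \<notin> J" using J step(3,4)[OF i] by blast+
    ultimately show ?thesis
      using fin by (simp add: family_insert)
  qed
  show main: "(\<Sum>i=1..n. (f (c i + m) - f (c i)) * (\<Sum>J | J \<subseteq> gap_T c m i \<and> card J = p - 1. ?E J i))
      = (\<Sum>I | I \<subseteq> apery S m \<and> card I = p. ?D I) - (\<Sum>I | I \<subseteq> {0..<m} \<and> card I = p. ?D I)"
    if p: "0 < p \<and> p \<le> m" for p
  proof -
    let ?h = "\<lambda>i. \<Sum>I | I \<subseteq> apery (gap_chain c i) m \<and> card I = p. ?D I"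
    have "(f (c i + m) - f (c i)) * (\<Sum>J | J \<subseteq> gap_T c m i \<and> card J = p - 1. ?E J i) = ?h i - ?h (i - 1)"
      if i: "i \<in> {1..n}" for i
    proof -
      have "(f (c i + m) - f (c i)) * (\<Sum>J | J \<subseteq> gap_T c m i \<and> card J = p - 1. ?E J i)
        = (\<Sum>J | J \<subseteq> gap_T c m i \<and> card J = p - 1. ?D (insert (c i + m) J))
          - (\<Sum>J | J \<subseteq> gap_T c m i \<and> card J = p - 1. ?D (insert (c i) J))"
        unfolding sum_distrib_left sum_subtractf[symmetric]
        by (intro sum.cong refl rec[OF i]) simp
      \<comment> \<open>Both Apery sets extend \<open>gap_T c m i\<close> by one element, so the
        \<open>p\<close>-subsets of \<open>gap_T c m i\<close> itself occur in both sums and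
        cancel.\<close>
      also have "\<dots> = ?h i - ?h (i - 1)"
        unfolding step(1,2)[OF i] using p step(3,4)[OF i]
        by (simp add: sum_subsets_insert finite_gap_T)
      finally show ?thesis .
    qed
    then show ?thesis
      using sum_telescope_from_1[of ?h n] unfolding ends by simp
  qed
  \<comment> \<open>For \<open>p = m\<close> every index family is a singleton:
    \<open>gap_T c m i\<close> has \<open>m - 1\<close> elements, the other two sets have
    \<open>m\<close>.\<close>
  have "{J. J \<subseteq> gap_T c m i \<and> card J = m - 1} = {gap_T c m i}" if "i \<in> {1..n}" for i
    by (intro subsets_full_card finite_gap_T card_gap_T[OF hyps that])
  moreover have "{I. I \<subseteq> apery S m \<and> card I = m} = {apery S m}"
    unfolding ends(2)[symmetric]
    by (intro subsets_full_card finite_apery_gap_chain card_apery_gap_chain[OF hyps order_refl])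
  moreover have "{I. I \<subseteq> {0..<m} \<and> card I = m} = {{0..<m}}"
    by (rule subsets_full_card) auto
  ultimately show "(\<Sum>i=1..n. (f (c i + m) - f (c i)) * ?E (gap_T c m i) i)
      = ?D (apery S m) - ?D {0..<m}"
    using main[of m] m by simp
qed

end
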